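(* Let $E$ be a $k$-dimensional linear subspace of $\mathbb{R}^n$ ($1\le k\le n$). Then the function $$p\mapsto\frac{\mathbb{E}\|G\|_{E\cap B_p^n}^p}{\mathbb{E}\|G\|_{B_p^k}^p}$$ is nonincreasing in $p>0$.
   Context: For $0<p<\infty$, $\|x\|_p=(\sum_i|x_i|^p)^{1/p}$. In $\mathbb{E}\|G\|_{E\cap B_p^n}^p$, $G$ is a standard Gaussian vector on the subspace $E$ and $\|G\|_{E\cap B_p^n}=\|G\|_p$ (the $\ell_p^n$ quasi-norm of $G\in E\subset\mathbb{R}^n$); in $\mathbb{E}\|G\|_{B_p^k}^p$, $G$ is a standard Gaussian vector in $\mathbb{R}^k$ and $\|G\|_{B_p^k}=\|G\|_p$ (the $\ell_p^k$ quasi-norm). *)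

theory Defs
  imports "HOL-Probability.Probability"
begin

definition lp_norm :: "real \<Rightarrow> real ^ 'n \<Rightarrow> real"
  where "lp_norm p x = (\<Sum>i\<in>UNIV. \<bar>x $ i\<bar> powr p) powr (1 / p)"

definition orthonormal_basis_of :: "'a::euclidean_space set \<Rightarrow> 'a set \<Rightarrow> bool"
  where "orthonormal_basis_of E B \<longleftrightarrow>
    B \<subseteq> E \<and> span B = E \<and> pairwise orthogonal B \<and> (\<forall>b\<in>B. norm b = 1)"

(* A standard Gaussian random vector on the Euclidean space E (a linear subspace of 'a):
   its coordinates in an orthonormal basis of E are i.i.d. N(0,1).  By rotation invariance
   the choice of the basis is irrelevant. *)
definition std_gaussian_vector_on ::
    "'w measure \<Rightarrow> 'a::euclidean_space set \<Rightarrow> ('w \<Rightarrow> 'a) \<Rightarrow> bool"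
  where "std_gaussian_vector_on M E G \<longleftrightarrow>
    prob_space M \<and> G \<in> borel_measurable M \<and> (AE \<omega> in M. G \<omega> \<in> E) \<and>
    (\<exists>B. orthonormal_basis_of E B \<and>
         prob_space.indep_vars M (\<lambda>_. borel) (\<lambda>b \<omega>. G \<omega> \<bullet> b) B \<and>
         (\<forall>b\<in>B. distributed M lborel (\<lambda>\<omega>. G \<omega> \<bullet> b) std_normal_density))"

end

theory Submission
  imports Defs
begin

text \<open>A coordinate $G_i$ of $G$ is a centred Gaussian whose standard deviation $\sigma_i$ is the norm
  of the projection of the unit vector $e_i$ to $E$, so $\sigma_i \le 1$. Hence the numerator is
  $c_p \sum_i \sigma_i^p$ with $c_p$ the absolute moment of order $p$ of $N(0,1)$, while all
  $\sigma_i$ equal 1 when $E$ is the whole space. The constants $c_p$ cancel in the quotient, and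
  each $\sigma_i^p$ is nonincreasing in $p$.\<close>

section \<open>Lengths of projections in coordinates of an orthonormal basis\<close>

text \<open>For an orthonormal basis \<open>B\<close> of a subspace this is the length of the
  orthogonal projection of \<open>v\<close> to it. The coordinate form is also the standard
  deviation of a combination of independent N(0,1) variables with coefficients
  \<open>b \<bullet> v\<close>.\<close>

definition proj_norm :: "'a::real_inner set \<Rightarrow> 'a \<Rightarrow> real"
  where "proj_norm B v = sqrt (\<Sum>b\<in>B. (b \<bullet> v)\<^sup>2)"

lemma proj_norm_nonneg [simp]: "0 \<le> proj_norm B v"
  by (simp add: proj_norm_def sum_nonneg)

lemma orthonormal_basis_of_finite:
  "orthonormal_basis_of E B \<Longrightarrow> finite B"
  unfolding orthonormal_basis_of_def by (blast intro: pairwise_orthogonal_imp_finite)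

lemma orthonormal_basis_of_expand:
  assumes "orthonormal_basis_of E B" "x \<in> E"
  shows "(\<Sum>b\<in>B. (x \<bullet> b) *\<^sub>R b) = x"
  using assms orthonormal_basis_of_finite[OF assms(1)]
  by (intro orthonormal_basis_expand) (auto simp: orthonormal_basis_of_def)

lemma proj_norm_eq_norm:
  assumes "orthonormal_basis_of E B" "v \<in> E"
  shows "proj_norm B v = norm v"
proof -
  have "v \<bullet> v = (\<Sum>b\<in>B. (v \<bullet> b) *\<^sub>R b) \<bullet> v"
    using orthonormal_basis_of_expand[OF assms] by simp
  also have "\<dots> = (\<Sum>b\<in>B. (b \<bullet> v)\<^sup>2)"
    by (simp add: inner_sum_left power2_eq_square inner_commute[of v])
  finally show ?thesis
    by (simp add: proj_norm_def norm_eq_sqrt_inner)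
qed

text \<open>Bessel's inequality: the projection \<open>y\<close> of \<open>v\<close> satisfies |y|^2
  = y . v, so Cauchy-Schwarz gives |y| \<le> |v|.\<close>

lemma proj_norm_le_norm:
  assumes B: "orthonormal_basis_of E B"
  shows "proj_norm B v \<le> norm v"
proof -
  define y where "y = (\<Sum>b\<in>B. (b \<bullet> v) *\<^sub>R b)"
  have "y \<in> span B"
    unfolding y_def by (intro span_sum span_scale span_base)
  then have "y \<in> E"
    using B by (simp add: orthonormal_basis_of_def)
  \<comment> \<open>By orthonormality \<open>y\<close> and \<open>v\<close> have the same
    coordinates along \<open>B\<close>, and \<open>y\<close> lies in \<open>E\<close>, where
    Parseval's identity applies.\<close>
  have "y \<bullet> b = b \<bullet> v" if "b \<in> B" for b
  proof -
    have "y \<bullet> b = (\<Sum>a\<in>B. if a = b then b \<bullet> v else 0)"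
      unfolding y_def inner_sum_left using B that
      by (intro sum.cong)
        (auto simp: orthonormal_basis_of_def pairwise_def orthogonal_def norm_eq_1)
    then show ?thesis
      using that orthonormal_basis_of_finite[OF B] by simp
  qed
  then have "proj_norm B v = proj_norm B y"
    by (simp add: proj_norm_def inner_commute)
  then have norm_y: "norm y = proj_norm B v"
    using proj_norm_eq_norm[OF B \<open>y \<in> E\<close>] by simp
  have "(proj_norm B v)\<^sup>2 = y \<bullet> v"
    by (simp add: proj_norm_def sum_nonneg y_def inner_sum_left power2_eq_square)
  also have "\<dots> \<le> norm y * norm v"
    by (rule norm_cauchy_schwarz)
  finally have "proj_norm B v * proj_norm B v \<le> proj_norm B v * norm v"
    by (simp add: norm_y power2_eq_square)
  then show ?thesis
    using proj_norm_nonneg[of B v] by (cases "proj_norm B v = 0") auto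
qed

section \<open>Absolute moments of the standard normal density\<close>

definition normal_abs_moment :: "real \<Rightarrow> real"
  where "normal_abs_moment p = (\<integral>x. std_normal_density x * \<bar>x\<bar> powr p \<partial>lborel)"

text \<open>A real exponent is dominated by integer ones: |x|^p is at most 1 where |x| \<le> 1 and
  at most x^(2m) elsewhere. The doubled exponent keeps the bound nonnegative for negative
  \<open>x\<close>.\<close>

lemma integrable_normal_abs_powr:
  assumes "0 < p"
  shows "integrable lborel (\<lambda>x. std_normal_density x * \<bar>x\<bar> powr p)"
proof -
  obtain m where m: "p \<le> real m"
    using real_arch_simple by blast
  show ?thesis
  proof (rule Bochner_Integration.integrable_bound)
    \<comment> \<open>The factor \<open>x ^ 0\<close> writes the constant 1 as a moment, so that one
      library rule covers both summands.\<close>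
    show "integrable lborel (\<lambda>x. std_normal_density x * x ^ 0 + std_normal_density x * x ^ (2 * m))"
      by (intro Bochner_Integration.integrable_add integrable_std_normal_moment)
    have "\<bar>x\<bar> powr p \<le> 1 + x ^ (2 * m)" for x :: real
    proof (cases "\<bar>x\<bar> \<le> 1")
      case True
      then have "\<bar>x\<bar> powr p \<le> 1"
        using \<open>0 < p\<close> by (simp add: powr_le1)
      then show ?thesis
        by (simp add: add_increasing2)
    next
      case False
      then have "\<bar>x\<bar> powr p \<le> \<bar>x\<bar> powr real (2 * m)"
        using m by (intro powr_mono) auto
      also have "\<dots> = x ^ (2 * m)"
        using False by (subst powr_realpow) (auto simp: power_mult)
      finally show ?thesis
        by simp
    qed
    then have "std_normal_density x * \<bar>x\<bar> powr p \<le> std_normal_density x * (1 + x ^ (2 * m))" for x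
      by (intro mult_left_mono) simp_all
    then show "AE x in lborel. norm (std_normal_density x * \<bar>x\<bar> powr p)
        \<le> norm (std_normal_density x * x ^ 0 + std_normal_density x * x ^ (2 * m))"
      by (intro AE_I2) (simp add: abs_mult ring_distribs)
  qed measurable
qed

text \<open>The integrand is nonnegative and vanishes only at 0, a null set. Positivity is what
  allows the constant to be cancelled in the quotient.\<close>

lemma normal_abs_moment_pos:
  assumes "0 < p"
  shows "0 < normal_abs_moment p"
proof -
  have nonneg: "AE x in lborel. 0 \<le> std_normal_density x * \<bar>x\<bar> powr p"
    by simp
  have "normal_abs_moment p \<noteq> 0"
  proof
    assume "normal_abs_moment p = 0"
    then have "AE x in lborel. std_normal_density x * \<bar>x\<bar> powr p = 0"
      using integral_nonneg_eq_0_iff_AE[OF integrable_normal_abs_powr[OF assms] nonneg]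
      by (simp add: normal_abs_moment_def)
    moreover have "AE x in lborel. x \<noteq> (0::real)"
      by (rule AE_lborel_singleton)
    ultimately have "AE x in (lborel :: real measure). False"
    proof eventually_elim
      case (elim x)
      then show ?case
        using normal_density_pos[of 1 0 x] by simp
    qed
    \<comment> \<open>A property false almost everywhere would make the whole line a null
      set.\<close>
    then show False
      using AE_iff_measurable[of UNIV "lborel :: real measure" "\<lambda>_. False"] by simp
  qed
  moreover have "0 \<le> normal_abs_moment p"
    unfolding normal_abs_moment_def by (rule integral_nonneg_AE[OF nonneg])
  ultimately show ?thesis
    by simp
qed

section \<open>Absolute moments of linear functionals of a Gaussian vector\<close>

lemma (in prob_space) std_normal_abs_powr_moment:
  assumes "distributed M lborel X std_normal_density" "0 < p"
  shows "integrable M (\<lambda>\<omega>. \<bar>X \<omega>\<bar> powr p)"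
    and "expectation (\<lambda>\<omega>. \<bar>X \<omega>\<bar> powr p) = normal_abs_moment p"
  using distributed_integrable[OF assms(1), of "\<lambda>x. \<bar>x\<bar> powr p"]
    distributed_integral[OF assms(1), of "\<lambda>x. \<bar>x\<bar> powr p"]
    integrable_normal_abs_powr[OF assms(2)]
  by (simp_all add: normal_abs_moment_def)

lemma (in prob_space) normal_abs_powr_moment:
  assumes X: "distributed M lborel X (normal_density 0 \<sigma>)" and "0 < \<sigma>" "0 < p"
  shows "integrable M (\<lambda>\<omega>. \<bar>X \<omega>\<bar> powr p)"
    and "expectation (\<lambda>\<omega>. \<bar>X \<omega>\<bar> powr p) = normal_abs_moment p * \<sigma> powr p"
proof -
  have "distributed M lborel (\<lambda>\<omega>. (X \<omega> - 0) / \<sigma>) std_normal_density"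
    using X normal_standard_normal_convert[OF \<open>0 < \<sigma>\<close>] by blast
  note std = std_normal_abs_powr_moment[OF this \<open>0 < p\<close>]
  have eq: "\<bar>X \<omega>\<bar> powr p = \<sigma> powr p * \<bar>(X \<omega> - 0) / \<sigma>\<bar> powr p" for \<omega>
    using \<open>0 < \<sigma>\<close> by (simp add: powr_divide)
  show "integrable M (\<lambda>\<omega>. \<bar>X \<omega>\<bar> powr p)"
    unfolding eq using std(1) by (intro integrable_mult_right)
  show "expectation (\<lambda>\<omega>. \<bar>X \<omega>\<bar> powr p) = normal_abs_moment p * \<sigma> powr p"
    unfolding eq using std(2) by simp
qed

text \<open>Variances of independent normal variables add up.\<close>

lemma (in prob_space) distributed_linear_combination_std_normal:
  assumes fin: "finite B"
    and indep: "indep_vars (\<lambda>_. borel) X B"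
    and std: "\<And>b. b \<in> B \<Longrightarrow> distributed M lborel (X b) std_normal_density"
    and nonzero: "\<exists>b\<in>B. c b \<noteq> 0"
  shows "distributed M lborel (\<lambda>\<omega>. \<Sum>b\<in>B. c b * X b \<omega>)
    (normal_density 0 (sqrt (\<Sum>b\<in>B. (c b)\<^sup>2)))"
proof -
  \<comment> \<open>A term with coefficient 0 is a point mass without a density, while
    \<open>sum_indep_normal\<close> asks for positive standard deviations. Dropping such terms
    changes neither the sum nor the variance.\<close>
  define B' where "B' = {b \<in> B. c b \<noteq> 0}"
  have "distributed M lborel (\<lambda>\<omega>. \<Sum>b\<in>B'. c b * X b \<omega>)
      (normal_density (\<Sum>b\<in>B'. 0) (sqrt (\<Sum>b\<in>B'. \<bar>c b\<bar>\<^sup>2)))"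
  proof (rule sum_indep_normal)
    show "indep_vars (\<lambda>_. borel) (\<lambda>b \<omega>. c b * X b \<omega>) B'"
      using indep_vars_compose2[OF indep_vars_subset[OF indep, of B'], of "\<lambda>b x. c b * x"]
      by (auto simp: B'_def)
    show "distributed M lborel (\<lambda>\<omega>. c b * X b \<omega>) (normal_density 0 \<bar>c b\<bar>)" if "b \<in> B'" for b
      using normal_density_affine[OF std, of b "c b" 0] that by (simp add: B'_def)
  qed (use fin nonzero in \<open>auto simp: B'_def\<close>)
  moreover have "(\<Sum>b\<in>B'. c b * X b \<omega>) = (\<Sum>b\<in>B. c b * X b \<omega>)" for \<omega>
    using fin by (intro sum.mono_neutral_left) (auto simp: B'_def)
  moreover have "(\<Sum>b\<in>B'. \<bar>c b\<bar>\<^sup>2) = (\<Sum>b\<in>B. (c b)\<^sup>2)"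
    using fin by (simp, intro sum.mono_neutral_left) (auto simp: B'_def)
  ultimately show ?thesis
    by simp
qed

text \<open>Expanding \<open>G\<close> in the basis turns its inner product with \<open>v\<close>
  almost surely into the combination \<open>Y\<close> of independent coordinates, a centred normal
  variable of standard deviation \<open>proj_norm B v\<close>.\<close>

lemma (in prob_space) gaussian_inner_abs_powr_moment:
  assumes B: "orthonormal_basis_of E B"
    and G: "G \<in> borel_measurable M" "AE \<omega> in M. G \<omega> \<in> E"
    and indep: "indep_vars (\<lambda>_. borel) (\<lambda>b \<omega>. G \<omega> \<bullet> b) B"
    and std: "\<And>b. b \<in> B \<Longrightarrow> distributed M lborel (\<lambda>\<omega>. G \<omega> \<bullet> b) std_normal_density"
    and "0 < p"
  shows "integrable M (\<lambda>\<omega>. \<bar>G \<omega> \<bullet> v\<bar> powr p)"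
    and "expectation (\<lambda>\<omega>. \<bar>G \<omega> \<bullet> v\<bar> powr p) = normal_abs_moment p * proj_norm B v powr p"
proof -
  define Y where "Y \<omega> = (\<Sum>b\<in>B. (b \<bullet> v) * (G \<omega> \<bullet> b))" for \<omega>
  have fin: "finite B"
    using B by (rule orthonormal_basis_of_finite)
  have [measurable]: "G \<in> borel_measurable M" "Y \<in> borel_measurable M"
    using G(1) by (simp_all add: Y_def[abs_def])
  have AE: "AE \<omega> in M. \<bar>G \<omega> \<bullet> v\<bar> powr p = \<bar>Y \<omega>\<bar> powr p"
    using G(2)
  proof eventually_elim
    case (elim \<omega>)
    have "G \<omega> \<bullet> v = (\<Sum>b\<in>B. (G \<omega> \<bullet> b) *\<^sub>R b) \<bullet> v"
      using orthonormal_basis_of_expand[OF B elim] by simp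
    then show ?case
      by (simp add: Y_def inner_sum_left mult.commute)
  qed
  have "integrable M (\<lambda>\<omega>. \<bar>Y \<omega>\<bar> powr p) \<and>
    expectation (\<lambda>\<omega>. \<bar>Y \<omega>\<bar> powr p) = normal_abs_moment p * proj_norm B v powr p"
  proof (cases "\<exists>b\<in>B. b \<bullet> v \<noteq> 0")
    case True
    then have "0 < (\<Sum>b\<in>B. (b \<bullet> v)\<^sup>2)"
      using fin by (auto intro: sum_pos2)
    then have "0 < proj_norm B v"
      by (simp add: proj_norm_def)
    moreover have "distributed M lborel Y (normal_density 0 (proj_norm B v))"
      unfolding Y_def[abs_def] proj_norm_def
      using fin indep std True by (rule distributed_linear_combination_std_normal)
    ultimately show ?thesis
      using normal_abs_powr_moment \<open>0 < p\<close> by blast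
  next
    \<comment> \<open>Here \<open>v\<close> is orthogonal to \<open>E\<close>, so \<open>Y\<close>
      is identically 0 and has no density; both sides vanish because
      \<open>0 powr p = 0\<close>.\<close>
    case False
    then show ?thesis
      by (simp add: Y_def proj_norm_def)
  qed
  then show "integrable M (\<lambda>\<omega>. \<bar>G \<omega> \<bullet> v\<bar> powr p)"
    and "expectation (\<lambda>\<omega>. \<bar>G \<omega> \<bullet> v\<bar> powr p) = normal_abs_moment p * proj_norm B v powr p"
    using integrable_cong_AE[OF _ _ AE] integral_cong_AE[OF _ _ AE] by simp_all
qed

section \<open>Moments of the quasi-norm and the quotient\<close>

lemma lp_norm_powr:
  "0 < p \<Longrightarrow> lp_norm p x powr p = (\<Sum>i\<in>UNIV. \<bar>x $ i\<bar> powr p)"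
  by (simp add: lp_norm_def powr_powr sum_nonneg)

text \<open>The p-th power of the quasi-norm is a sum over coordinates, so linearity of expectation
  suffices. The basis is obtained before \<open>p\<close>: the same projection lengths serve all
  exponents, which makes different \<open>p\<close> comparable.\<close>

lemma std_gaussian_vector_on_lp_moment:
  fixes G :: "'w \<Rightarrow> real ^ 'n"
  assumes "std_gaussian_vector_on M E G"
  obtains B where "orthonormal_basis_of E B"
    and "\<And>p. 0 < p \<Longrightarrow> prob_space.expectation M (\<lambda>\<omega>. lp_norm p (G \<omega>) powr p) =
      normal_abs_moment p * (\<Sum>i\<in>UNIV. proj_norm B (axis i 1) powr p)"
proof -
  interpret prob_space M
    using assms by (simp add: std_gaussian_vector_on_def)
  obtain B where B: "orthonormal_basis_of E B"
    and indep: "indep_vars (\<lambda>_. borel) (\<lambda>b \<omega>. G \<omega> \<bullet> b) B"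
    and std: "\<And>b. b \<in> B \<Longrightarrow> distributed M lborel (\<lambda>\<omega>. G \<omega> \<bullet> b) std_normal_density"
    and G: "G \<in> borel_measurable M" "AE \<omega> in M. G \<omega> \<in> E"
    using assms by (auto simp: std_gaussian_vector_on_def)
  note moment = gaussian_inner_abs_powr_moment[OF B G indep std]
  show thesis
  proof (rule that[OF B])
    fix p :: real
    assume "0 < p"
    have "expectation (\<lambda>\<omega>. lp_norm p (G \<omega>) powr p) =
        expectation (\<lambda>\<omega>. \<Sum>i\<in>UNIV. \<bar>G \<omega> \<bullet> axis i 1\<bar> powr p)"
      using \<open>0 < p\<close> by (simp add: lp_norm_powr inner_axis)
    also have "\<dots> = (\<Sum>i\<in>UNIV. normal_abs_moment p * proj_norm B (axis i 1) powr p)"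
      using moment[OF _ \<open>0 < p\<close>] by (subst Bochner_Integration.integral_sum) simp_all
    finally show "expectation (\<lambda>\<omega>. lp_norm p (G \<omega>) powr p) =
        normal_abs_moment p * (\<Sum>i\<in>UNIV. proj_norm B (axis i 1) powr p)"
      by (simp add: sum_distrib_left)
  qed
qed

theorem theorem8:
  fixes E :: "(real ^ 'n) set"
    and M :: "'w measure" and G :: "'w \<Rightarrow> real ^ 'n"
    and N :: "'v measure" and H :: "'v \<Rightarrow> real ^ 'k"
  assumes "subspace E"
    and "dim E = CARD('k)"
    and "std_gaussian_vector_on M E G"
    and "std_gaussian_vector_on N (UNIV :: (real ^ 'k) set) H"
  shows "antimono_on {0<..}
    (\<lambda>p. prob_space.expectation M (\<lambda>\<omega>. lp_norm p (G \<omega>) powr p) /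
         prob_space.expectation N (\<lambda>\<omega>. lp_norm p (H \<omega>) powr p))"
proof -
  obtain B where B: "orthonormal_basis_of E B"
    and numerator: "\<And>p. 0 < p \<Longrightarrow>
      prob_space.expectation M (\<lambda>\<omega>. lp_norm p (G \<omega>) powr p) =
        normal_abs_moment p * (\<Sum>i\<in>UNIV. proj_norm B (axis i 1) powr p)"
    using std_gaussian_vector_on_lp_moment[OF assms(3)] by blast
  obtain C where C: "orthonormal_basis_of (UNIV :: (real ^ 'k) set) C"
    and denominator: "\<And>p. 0 < p \<Longrightarrow>
      prob_space.expectation N (\<lambda>\<omega>. lp_norm p (H \<omega>) powr p) =
        normal_abs_moment p * (\<Sum>i\<in>UNIV. proj_norm C (axis i 1) powr p)"
    using std_gaussian_vector_on_lp_moment[OF assms(4)] by blast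
  \<comment> \<open>Since \<open>C\<close> spans the whole space, every unit vector has projection
    length 1, and the denominator is the moment constant times \<open>CARD('k)\<close>.\<close>
  have ratio: "prob_space.expectation M (\<lambda>\<omega>. lp_norm p (G \<omega>) powr p) /
      prob_space.expectation N (\<lambda>\<omega>. lp_norm p (H \<omega>) powr p) =
      (\<Sum>i\<in>UNIV. proj_norm B (axis i 1) powr p) / real CARD('k)" if "0 < p" for p
    using normal_abs_moment_pos[OF that] proj_norm_eq_norm[OF C]
    by (simp add: numerator denominator that)
  have "proj_norm B (axis i 1) \<le> 1" for i
    using proj_norm_le_norm[OF B, of "axis i 1"] by simp
  then show ?thesis
    \<comment> \<open>\<open>powr_mono'\<close> reverses the order of exponents for bases between 0
      and 1. It includes base 0, which occurs when a unit vector is orthogonal to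
      \<open>E\<close>.\<close>
    by (intro monotone_onI) (auto simp: ratio intro!: divide_right_mono sum_mono powr_mono')
qed

end
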